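(* Let $d\ge1$ and let $J$ be an admissible interaction kernel on $\mathbb{Z}^d$ with tail index $\alpha\in(0,\infty]$. Let $\alpha'=\alpha/2$ if $\alpha\in(0,2)$ and $\alpha'=1$ if $\alpha\in[2,\infty]$. Let $$\sigma(\xi)=2\sum_{m\ne0}J_m\sin^2\Big(\frac{m\cdot\xi}{2}\Big),\qquad \xi\in\mathbb{T}^d=(-\pi,\pi]^d,$$ and let $\delta(r)=r^{2\alpha'}$ if $\alpha\ne2$ and $\delta(r)=r^2\langle\log r\rangle$ if $\alpha=2$ (with $\delta(0)=0$). Then $\sigma(\xi)\simeq\delta(|\xi|)$, i.e. there exist constants $0<c\le C$, independent of $\xi$, such that $c\,\delta(|\xi|)\le\sigma(\xi)\le C\,\delta(|\xi|)$ for all $\xi\in\mathbb{T}^d$.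
   Context: For lattice points $n\in\mathbb{Z}^d$, $|n|$ denotes the $l^1$ norm; for $\xi\in\mathbb{T}^d$, $|\xi|$ denotes the Euclidean norm; $\langle z\rangle=(|z|^2+1)^{1/2}$; $S_k=\{n\in\mathbb{Z}^d:|n|=k\}$. An admissible interaction kernel with tail index $\alpha\in(0,\infty]$ is a function $J:\mathbb{Z}^d\to[0,\infty)$ with $J_0=0$, $J_n=J_{-n}$ for all $n$, and $\sum_m J_m<\infty$, for which there is an envelope $\eta:\mathbb{N}\to[0,\infty)$ such that: if $\alpha<\infty$, there exist $0<C_1<C_2$ and $k_0\in\mathbb{N}$ with $C_1\le k^{d+\alpha}\eta(k)\le C_2$ for all $k\ge k_0$; if $\alpha=\infty$, $\lim_{k\to\infty}k^{d+\beta}\eta(k)=0$ for every $\beta<\infty$; and moreover (I) there exist $R,c_\pm>0$ such that $J_n\le c_+\eta(|n|)$ whenever $|n|\ge R$, and $\sum_{m\in S_k}J_m\ge c_-k^{d-1}\eta(k)$ whenever $k\ge R$; (II) $\min_{m\in S_1}J_m>0$. ($\sigma$ is the Fourier symbol of $(Lu)_n=\sum_{m\ne n}J_{n-m}(u_n-u_m)$.) *)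

theory Defs
  imports "HOL-Analysis.Analysis"
begin

definition l1_norm :: "int ^ 'd \<Rightarrow> nat"
  where "l1_norm n = nat (\<Sum>i\<in>UNIV. \<bar>n $ i\<bar>)"

definition l1_sphere :: "nat \<Rightarrow> (int ^ 'd) set"
  where "l1_sphere k = {n. l1_norm n = k}"

text \<open>The sums and the minimum over \<open>l1_sphere\<close> below range over finite nonempty sets.\<close>

lemma finite_l1_sphere: "finite (l1_sphere k :: (int ^ 'd) set)"
proof -
  have "l1_sphere k \<subseteq> vec_lambda ` (PiE (UNIV :: 'd set) (\<lambda>_. {- int k..int k}))"
  proof
    fix n :: "int ^ 'd"
    assume n: "n \<in> l1_sphere k"
    have "\<bar>n $ i\<bar> \<le> int k" for i
    proof -
      have "\<bar>n $ i\<bar> \<le> (\<Sum>i\<in>UNIV. \<bar>n $ i\<bar>)"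
        by (rule member_le_sum) auto
      also have "\<dots> = int k"
        using n by (auto simp: l1_sphere_def l1_norm_def sum_nonneg)
      finally show ?thesis .
    qed
    then have "($) n \<in> PiE UNIV (\<lambda>_. {- int k..int k})"
      by (auto simp: abs_le_iff minus_le_iff)
    moreover have "n = vec_lambda (($) n)" by simp
    ultimately show "n \<in> vec_lambda ` (PiE UNIV (\<lambda>_. {- int k..int k}))" by blast
  qed
  then show ?thesis
    by (rule finite_subset) (intro finite_imageI finite_PiE; simp)
qed

lemma l1_sphere_nonempty: "(l1_sphere k :: (int ^ 'd) set) \<noteq> {}"
proof -
  obtain j :: 'd where True by simp
  have "(\<Sum>i\<in>UNIV. \<bar>(\<chi> i. if i = j then int k else 0) $ i\<bar>) = int k"
    by (simp add: if_distrib cong: if_cong)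
  then have "(\<chi> i. if i = j then int k else 0) \<in> l1_sphere k"
    by (simp add: l1_sphere_def l1_norm_def)
  then show ?thesis by blast
qed

definition tail_envelope :: "nat \<Rightarrow> ereal \<Rightarrow> (nat \<Rightarrow> real) \<Rightarrow> bool"
  where "tail_envelope d \<alpha> \<eta> \<longleftrightarrow>
    (\<forall>k. 0 \<le> \<eta> k) \<and>
    (\<alpha> < \<infinity> \<longrightarrow>
      (\<exists>C\<^sub>1 C\<^sub>2 k\<^sub>0. 0 < C\<^sub>1 \<and> C\<^sub>1 < C\<^sub>2 \<and>
        (\<forall>k\<ge>k\<^sub>0. C\<^sub>1 \<le> real k powr (real d + real_of_ereal \<alpha>) * \<eta> k \<and>
                 real k powr (real d + real_of_ereal \<alpha>) * \<eta> k \<le> C\<^sub>2))) \<and>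
    (\<alpha> = \<infinity> \<longrightarrow>
      (\<forall>\<beta>::real. (\<lambda>k. real k powr (real d + \<beta>) * \<eta> k) \<longlonglongrightarrow> 0))"

definition admissible_kernel :: "ereal \<Rightarrow> (int ^ 'd \<Rightarrow> real) \<Rightarrow> bool"
  where "admissible_kernel \<alpha> J \<longleftrightarrow>
    0 < \<alpha> \<and>
    (\<forall>n. 0 \<le> J n) \<and> J 0 = 0 \<and> (\<forall>n. J n = J (- n)) \<and> J summable_on UNIV \<and>
    (\<exists>\<eta>. tail_envelope CARD('d) \<alpha> \<eta> \<and>
      (\<exists>R c\<^sub>p c\<^sub>m. 0 < R \<and> 0 < c\<^sub>p \<and> 0 < c\<^sub>m \<and>
        (\<forall>n. R \<le> real (l1_norm n) \<longrightarrow> J n \<le> c\<^sub>p * \<eta> (l1_norm n)) \<and>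
        (\<forall>k. R \<le> real k \<longrightarrow>
          c\<^sub>m * real k ^ (CARD('d) - 1) * \<eta> k \<le> (\<Sum>m\<in>l1_sphere k. J m)))) \<and>
    0 < Min (J ` l1_sphere 1)"

definition torus :: "(real ^ 'd) set"
  where "torus = {\<xi>. \<forall>i. - pi < \<xi> $ i \<and> \<xi> $ i \<le> pi}"

definition symbol :: "(int ^ 'd \<Rightarrow> real) \<Rightarrow> real ^ 'd \<Rightarrow> real"
  where "symbol J \<xi> =
    2 * (\<Sum>\<^sub>\<infinity>m\<in>UNIV - {0}. J m * (sin ((\<Sum>i\<in>UNIV. of_int (m $ i) * \<xi> $ i) / 2))\<^sup>2)"

definition japanese_bracket :: "real \<Rightarrow> real"
  where "japanese_bracket z = sqrt (\<bar>z\<bar>\<^sup>2 + 1)"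

definition alpha' :: "ereal \<Rightarrow> real"
  where "alpha' \<alpha> = (if \<alpha> < 2 then real_of_ereal \<alpha> / 2 else 1)"

definition delta :: "ereal \<Rightarrow> real \<Rightarrow> real"
  where "delta \<alpha> r =
    (if r = 0 then 0
     else if \<alpha> = 2 then r\<^sup>2 * japanese_bracket (ln r)
     else r powr (2 * alpha' \<alpha>))"

end

theory Submission
  imports Defs
begin

text \<open>
  Split \<open>\<int>\<^sup>d\<close> into the dyadic \<open>l\<^sup>1\<close> shells \<open>K \<le> |m| < 2K\<close>, \<open>K = 2\<^sup>i\<close>, and write \<open>r\<close> for the
  Euclidean norm of \<open>\<xi>\<close>. A shell has mass at most a constant times \<open>K powr -\<alpha>\<close>, and
  \<open>sin\<^sup>2(m\<cdot>\<xi>/2) \<le> min 1 (K r)\<^sup>2\<close> there, so the upper bound is a geometric sum cut at \<open>K = 1/r\<close>;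
  at \<open>\<alpha> = 2\<close> each of the roughly \<open>log(1/r)\<close> lower shells contributes \<open>r\<^sup>2\<close>.

  For the lower bound, \<open>J\<close> may be very anisotropic, but it cannot concentrate near the hyperplane
  orthogonal to \<open>\<xi>\<close>: the slab \<open>|m\<cdot>\<xi>| \<le> \<epsilon> K r\<close> contains only \<open>O(\<epsilon> K\<^sup>d)\<close> points of the shell, and the
  pointwise bound on \<open>J\<close> makes their mass a small fraction of the mass of the shell. Hence a
  shell with \<open>K r \<le> 1\<close> contributes at least a constant times \<open>K powr (2 - \<alpha>) * r\<^sup>2\<close>. Nearest
  neighbours give \<open>\<sigma>(\<xi>) \<ge> c r\<^sup>2\<close>, which suffices when \<open>\<alpha> > 2\<close> or \<open>r\<close> is bounded below.
\<close>

subsection \<open>Dyadic shells and slabs\<close>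

text \<open>Jordan's inequality: by concavity \<open>sin\<close> lies above its chord on
  \<open>{0..pi/2}\<close>, and squaring removes the sign. It converts the sines of the symbol into
  quadratic terms in every lower bound below.\<close>

lemma jordan_sin_sq:
  fixes x :: real
  assumes "\<bar>x\<bar> \<le> pi / 2"
  shows "(2 * x / pi)\<^sup>2 \<le> (sin x)\<^sup>2"
proof -
  have conc: "concave_on {0..pi/2} sin"
    by (rule f''_le0_imp_concave[where f' = cos and f'' = "\<lambda>x. - sin x"])
      (auto intro!: derivative_eq_intros sin_ge_zero)
  have "2 * c / pi \<le> sin c" if "0 \<le> c" "c \<le> pi / 2" for c :: real
    using concave_onD_Icc'[OF conc, of c] that by simp
  from this[of "\<bar>x\<bar>"] have "2 * \<bar>x\<bar> / pi \<le> sin \<bar>x\<bar>" using assms by simp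
  then have "(2 * \<bar>x\<bar> / pi)\<^sup>2 \<le> (sin \<bar>x\<bar>)\<^sup>2" by (intro power_mono) auto
  then show ?thesis by (cases "x \<ge> 0") (auto simp: power2_eq_square)
qed

definition lattice_inner :: "int ^ 'd \<Rightarrow> real ^ 'd \<Rightarrow> real"
  where "lattice_inner m \<xi> = (\<Sum>i\<in>UNIV. of_int (m $ i) * \<xi> $ i)"

text \<open>Half-open, so that the shells with \<open>K = 2 ^ i\<close> partition the nonzero
  lattice points.\<close>

definition shell :: "nat \<Rightarrow> (int ^ 'd) set"
  where "shell K = {m. K \<le> l1_norm m \<and> l1_norm m < 2 * K}"

lemma of_nat_l1_norm: "real (l1_norm m) = (\<Sum>i\<in>UNIV. \<bar>of_int (m $ i)\<bar>)"
  by (simp add: l1_norm_def sum_nonneg)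

lemma l1_norm_eq_0_iff: "l1_norm m = 0 \<longleftrightarrow> m = 0"
proof
  assume "l1_norm m = 0"
  then have "(\<Sum>i\<in>UNIV. \<bar>m $ i\<bar>) \<le> 0" by (simp add: l1_norm_def)
  then have "(\<Sum>i\<in>UNIV. \<bar>m $ i\<bar>) = 0" by (intro antisym sum_nonneg) auto
  then have "m $ i = 0" for i
    by (subst (asm) sum_nonneg_eq_0_iff) auto
  then show "m = 0" by (simp add: vec_eq_iff)
qed (simp add: l1_norm_def)

lemma abs_component_le_l1_norm: "\<bar>m $ i\<bar> \<le> int (l1_norm m)"
proof -
  have "\<bar>m $ i\<bar> \<le> (\<Sum>i\<in>UNIV. \<bar>m $ i\<bar>)" by (rule member_le_sum) auto
  then show ?thesis by (simp add: l1_norm_def)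
qed

lemma abs_lattice_inner_le: "\<bar>lattice_inner m \<xi>\<bar> \<le> real (l1_norm m) * norm \<xi>"
proof -
  have "\<bar>lattice_inner m \<xi>\<bar> \<le> (\<Sum>i\<in>UNIV. \<bar>of_int (m $ i) * \<xi> $ i\<bar>)"
    unfolding lattice_inner_def by (rule sum_abs)
  also have "\<dots> \<le> (\<Sum>i\<in>UNIV. \<bar>of_int (m $ i)\<bar> * norm \<xi>)"
    by (intro sum_mono) (auto simp: abs_mult intro!: mult_left_mono component_le_norm_cart)
  finally show ?thesis by (simp add: of_nat_l1_norm sum_distrib_right)
qed

lemma shell_eq_UN: "shell K = (\<Union>k\<in>{K..<2*K}. l1_sphere k)"
  by (auto simp: shell_def l1_sphere_def)

lemma finite_shell: "finite (shell K)"
  by (simp add: shell_eq_UN finite_l1_sphere)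

lemma sum_shell: "(\<Sum>m\<in>shell K. f m) = (\<Sum>k\<in>{K..<2*K}. \<Sum>m\<in>l1_sphere k. f m)"
  unfolding shell_eq_UN
  by (rule sum.UNION_disjoint) (auto simp: finite_l1_sphere, auto simp: l1_sphere_def)

lemma disjoint_dyadic_shells: "disjoint_family_on (\<lambda>i. shell (2 ^ i)) I"
proof -
  have "i = j" if "m \<in> shell (2 ^ i)" "m \<in> shell (2 ^ j)" for m :: "int ^ 'a" and i j
  proof -
    have "(2::nat) ^ i < 2 ^ Suc j" "(2::nat) ^ j < 2 ^ Suc i"
      using that by (auto simp: shell_def)
    then have "i < Suc j" "j < Suc i" by (metis power_less_imp_less_exp one_less_numeral_iff semiring_norm(76))+
    then show ?thesis by simp
  qed
  then show ?thesis by (auto simp: disjoint_family_on_def)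
qed

lemma dyadic_shell_exists:
  assumes "m \<noteq> 0"
  shows "\<exists>i. m \<in> shell (2 ^ i)"
proof -
  have "l1_norm m > 0" using assms l1_norm_eq_0_iff[of m] by auto
  then show ?thesis
    using ex_power_ivl1[of 2 "l1_norm m"] by (auto simp: shell_def)
qed

section \<open>Counting lattice points near a hyperplane\<close>

text \<open>The solutions are the integers in an interval with centre \<open>- c / x\<close> and
  radius \<open>b / \<bar>x\<bar>\<close>; an interval of length \<open>l\<close> holds at most
  \<open>1 + l\<close> integers.\<close>

lemma card_int_affine_le:
  fixes c x b :: real
  assumes "x \<noteq> 0" "0 \<le> b"
  shows "finite {t::int. \<bar>c + of_int t * x\<bar> \<le> b}"
    and "real (card {t::int. \<bar>c + of_int t * x\<bar> \<le> b}) \<le> 1 + 2 * b / \<bar>x\<bar>"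
proof -
  define p where "p = - c / x"
  define q where "q = b / \<bar>x\<bar>"
  have sub: "{t::int. \<bar>c + of_int t * x\<bar> \<le> b} \<subseteq> {\<lceil>p - q\<rceil>..\<lfloor>p + q\<rfloor>}"
  proof safe
    fix t :: int assume "\<bar>c + of_int t * x\<bar> \<le> b"
    moreover have "c + of_int t * x = (of_int t - p) * x" using assms by (simp add: p_def field_simps)
    ultimately have "\<bar>of_int t - p\<bar> * \<bar>x\<bar> \<le> b" by (simp add: abs_mult)
    then have "\<bar>of_int t - p\<bar> \<le> q" using assms by (simp add: q_def field_simps)
    then show "t \<in> {\<lceil>p - q\<rceil>..\<lfloor>p + q\<rfloor>}" by (auto simp: ceiling_le_iff le_floor_iff)
  qed
  then show "finite {t::int. \<bar>c + of_int t * x\<bar> \<le> b}" using finite_subset by blast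
  have "card {t::int. \<bar>c + of_int t * x\<bar> \<le> b} \<le> card {\<lceil>p - q\<rceil>..\<lfloor>p + q\<rfloor>}"
    by (intro card_mono sub) auto
  moreover have "real (card {\<lceil>p - q\<rceil>..\<lfloor>p + q\<rfloor>}) \<le> 1 + 2 * q"
  proof -
    have "0 \<le> q" using assms by (simp add: q_def)
    then show ?thesis by simp linarith
  qed
  ultimately show "real (card {t::int. \<bar>c + of_int t * x\<bar> \<le> b}) \<le> 1 + 2 * b / \<bar>x\<bar>"
    by (simp add: q_def)
qed

text \<open>Otherwise the components would sum to less than the Euclidean norm, which the l1 norm
  dominates.\<close>

lemma exists_large_component:
  fixes \<xi> :: "real ^ 'd"
  shows "\<exists>j. norm \<xi> \<le> CARD('d) * \<bar>\<xi> $ j\<bar>"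
proof (rule ccontr)
  assume "\<not> ?thesis"
  then have "\<bar>\<xi> $ j\<bar> < norm \<xi> / CARD('d)" for j by (simp add: not_le field_simps)
  then have "(\<Sum>j\<in>UNIV. \<bar>\<xi> $ j\<bar>) < (\<Sum>j\<in>(UNIV::'d set). norm \<xi> / CARD('d))"
    by (intro sum_strict_mono) auto
  then show False using norm_le_l1_cart[of \<xi>] by simp
qed

text \<open>Fixing all coordinates but a dominant one of \<open>\<xi>\<close> leaves an interval for that coordinate.\<close>

lemma card_near_hyperplane_le:
  fixes \<xi> :: "real ^ 'd" and b :: real
  assumes "\<xi> \<noteq> 0" "0 \<le> b"
  shows "real (card {m \<in> shell K. \<bar>lattice_inner m \<xi>\<bar> \<le> b * norm \<xi>})
    \<le> (4 * real K + 1) ^ (CARD('d) - 1) * (1 + 2 * CARD('d) * b)"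
proof -
  obtain j where j: "norm \<xi> \<le> CARD('d) * \<bar>\<xi> $ j\<bar>" using exists_large_component by blast
  have xj: "\<xi> $ j \<noteq> 0" using j assms by auto
  \<comment> \<open>\<open>P\<close> holds the possible values of the coordinates other than
    \<open>j\<close>, \<open>T g\<close> the values of coordinate \<open>j\<close> compatible with
    \<open>g\<close>, and \<open>v\<close> reassembles the vector.\<close>
  define P where "P = PiE (UNIV - {j}) (\<lambda>_. {- int (2 * K)..int (2 * K)})"
  define T where "T g = {t::int. \<bar>(\<Sum>i\<in>UNIV - {j}. of_int (g i) * \<xi> $ i) + of_int t * \<xi> $ j\<bar> \<le> b * norm \<xi>}" for g
  define v where "v g t = (\<chi> i. if i = j then t else g i)" for g :: "'d \<Rightarrow> int" and t
  have box: "card {- int (2 * K)..int (2 * K)} = 4 * K + 1" by simp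
  have finP: "finite P" unfolding P_def by (intro finite_PiE) auto
  have finT: "finite (T g)" for g unfolding T_def by (intro card_int_affine_le xj) (use assms in auto)
  have cardT: "real (card (T g)) \<le> 1 + 2 * CARD('d) * b" for g
  proof -
    have "real (card (T g)) \<le> 1 + 2 * (b * norm \<xi>) / \<bar>\<xi> $ j\<bar>"
      unfolding T_def by (intro card_int_affine_le xj) (use assms in auto)
    \<comment> \<open>Dominance of component \<open>j\<close> is what makes the bound independent of
      \<xi>.\<close>
    also have "2 * (b * norm \<xi>) / \<bar>\<xi> $ j\<bar> \<le> 2 * (b * (CARD('d) * \<bar>\<xi> $ j\<bar>)) / \<bar>\<xi> $ j\<bar>"
      using assms by (intro divide_right_mono mult_left_mono j) auto
    finally show ?thesis using xj by (simp add: mult_ac)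
  qed
  have "{m \<in> shell K. \<bar>lattice_inner m \<xi>\<bar> \<le> b * norm \<xi>} \<subseteq> (\<Union>g\<in>P. v g ` T g)"
  proof
    fix m assume m: "m \<in> {m \<in> shell K. \<bar>lattice_inner m \<xi>\<bar> \<le> b * norm \<xi>}"
    define g where "g = restrict (($) m) (UNIV - {j})"
    have "\<bar>m $ i\<bar> \<le> int (2 * K)" for i
      using abs_component_le_l1_norm[of m i] m by (auto simp: shell_def)
    then have gP: "g \<in> P" by (auto simp: P_def g_def abs_le_iff minus_le_iff)
    have "lattice_inner m \<xi> = (\<Sum>i\<in>UNIV - {j}. of_int (g i) * \<xi> $ i) + of_int (m $ j) * \<xi> $ j"
      unfolding lattice_inner_def by (subst sum.remove[of _ j]) (auto simp: g_def)
    then have "m $ j \<in> T g" using m by (auto simp: T_def)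
    moreover have "m = v g (m $ j)" by (auto simp: v_def g_def vec_eq_iff)
    ultimately show "m \<in> (\<Union>g\<in>P. v g ` T g)" using gP by blast
  qed
  then have "card {m \<in> shell K. \<bar>lattice_inner m \<xi>\<bar> \<le> b * norm \<xi>} \<le> card (\<Union>g\<in>P. v g ` T g)"
    by (intro card_mono) (auto simp: finP finT)
  also have "\<dots> \<le> (\<Sum>g\<in>P. card (v g ` T g))" by (rule card_UN_le[OF finP])
  also have "\<dots> \<le> (\<Sum>g\<in>P. card (T g))" by (intro sum_mono card_image_le finT)
  finally have "real (card {m \<in> shell K. \<bar>lattice_inner m \<xi>\<bar> \<le> b * norm \<xi>}) \<le> (\<Sum>g\<in>P. real (card (T g)))"
    by (simp only: of_nat_le_iff flip: of_nat_sum)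
  also have "\<dots> \<le> (\<Sum>g\<in>P. 1 + 2 * CARD('d) * b)" by (intro sum_mono cardT)
  also have "\<dots> = real (card P) * (1 + 2 * CARD('d) * b)" by simp
  also have "card P = (4 * K + 1) ^ (CARD('d) - 1)"
    using box by (simp add: P_def card_PiE card_Diff_singleton)
  finally show ?thesis by (simp add: add_ac)
qed

lemma card_shell_le: "real (card (shell K :: (int ^ 'd) set)) \<le> (4 * real K + 1) ^ CARD('d)"
proof -
  define P where "P = PiE (UNIV :: 'd set) (\<lambda>_. {- int (2 * K)..int (2 * K)})"
  have box: "card {- int (2 * K)..int (2 * K)} = 4 * K + 1" by simp
  have finP: "finite P" unfolding P_def by (intro finite_PiE) auto
  have "shell K \<subseteq> vec_lambda ` P"
  proof
    fix m :: "int ^ 'd" assume m: "m \<in> shell K"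
    have "\<bar>m $ i\<bar> \<le> int (2 * K)" for i
      using abs_component_le_l1_norm[of m i] m by (auto simp: shell_def)
    then have "($) m \<in> P" by (auto simp: P_def abs_le_iff minus_le_iff)
    moreover have "m = vec_lambda (($) m)" by simp
    ultimately show "m \<in> vec_lambda ` P" by blast
  qed
  then have "card (shell K :: (int ^ 'd) set) \<le> card P" using surj_card_le[OF finP] by blast
  moreover have "card P = (4 * K + 1) ^ CARD('d)"
    using box by (simp add: P_def card_PiE)
  ultimately have "real (card (shell K :: (int ^ 'd) set)) \<le> real ((4 * K + 1) ^ CARD('d))" by (simp only: of_nat_le_iff)
  then show ?thesis by (simp add: add_ac)
qed

subsection \<open>Mass of a shell\<close>

lemma dyadic_powr: "(2 ^ i :: real) powr b = (2 powr b) ^ i"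
  by (simp add: powr_powr mult.commute flip: powr_realpow)

text \<open>For \<open>\<alpha> = \<infinity>\<close> any exponent above 2 gives the same \<open>delta\<close>, hence the choice 3.\<close>

lemma admissible_kernel_decay:
  fixes J :: "int ^ 'd \<Rightarrow> real" and a :: real
  assumes "admissible_kernel \<alpha> J" and a: "a = (if \<alpha> = \<infinity> then 3 else real_of_ereal \<alpha>)"
  shows "\<exists>C N. 0 < C \<and> 0 < N \<and> (\<forall>m. N \<le> l1_norm m \<longrightarrow> J m \<le> C * real (l1_norm m) powr - (CARD('d) + a))"
proof -
  obtain \<eta> R c\<^sub>p where \<eta>: "tail_envelope CARD('d) \<alpha> \<eta>" and cp: "0 < c\<^sub>p"
    and J: "\<And>n. R \<le> real (l1_norm n) \<Longrightarrow> J n \<le> c\<^sub>p * \<eta> (l1_norm n)" and \<alpha>: "0 < \<alpha>"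
    using assms(1) unfolding admissible_kernel_def by blast
  have "\<exists>C k\<^sub>0. 0 < C \<and> (\<forall>k\<ge>k\<^sub>0. real k powr (real CARD('d) + a) * \<eta> k \<le> C)"
  proof (cases "\<alpha> = \<infinity>")
    case False
    then have "\<alpha> < \<infinity>" by simp
    with \<eta> obtain C\<^sub>1 C\<^sub>2 k\<^sub>0 where "0 < C\<^sub>1" "C\<^sub>1 < C\<^sub>2"
      "\<And>k. k \<ge> k\<^sub>0 \<Longrightarrow> real k powr (real CARD('d) + real_of_ereal \<alpha>) * \<eta> k \<le> C\<^sub>2"
      unfolding tail_envelope_def by blast
    then show ?thesis using False a by (intro exI[of _ C\<^sub>2] exI[of _ k\<^sub>0]) auto
  next
    case True
    with \<eta> a have "(\<lambda>k. real k powr (real CARD('d) + a) * \<eta> k) \<longlonglongrightarrow> 0"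
      unfolding tail_envelope_def by auto
    then have "eventually (\<lambda>k. real k powr (real CARD('d) + a) * \<eta> k < 1) sequentially"
      by (rule order_tendstoD) simp
    then show ?thesis unfolding eventually_sequentially by (meson less_imp_le zero_less_one)
  qed
  then obtain C k\<^sub>0 where C: "0 < C" "\<And>k. k \<ge> k\<^sub>0 \<Longrightarrow> real k powr (real CARD('d) + a) * \<eta> k \<le> C" by blast
  \<comment> \<open>The entry 1 keeps the l1 norm positive, so that its power can be moved across
    the inequality.\<close>
  define N where "N = max (max 1 k\<^sub>0) (nat \<lceil>R\<rceil>)"
  have "J m \<le> c\<^sub>p * C * real (l1_norm m) powr - (CARD('d) + a)" if m: "N \<le> l1_norm m" for m
  proof -
    have "J m \<le> c\<^sub>p * \<eta> (l1_norm m)" using m by (intro J) (simp add: N_def nat_le_iff ceiling_le_iff)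
    also have "\<eta> (l1_norm m) \<le> C * real (l1_norm m) powr - (CARD('d) + a)"
      using C(2)[of "l1_norm m"] m
      by (simp only: powr_minus) (simp add: N_def field_simps)
    finally show ?thesis using cp by (simp add: mult_ac)
  qed
  then show ?thesis using cp C(1) by (intro exI[of _ "c\<^sub>p * C"] exI[of _ N]) (auto simp: N_def)
qed

text \<open>The factor \<open>k ^ (d - 1)\<close> of condition (I) meets the envelope of order
  \<open>k powr - (d + \<alpha>)\<close>. The envelope has a lower bound of this kind only for
  finite \<alpha>.\<close>

lemma admissible_kernel_sphere_mass:
  fixes J :: "int ^ 'd \<Rightarrow> real"
  assumes "admissible_kernel \<alpha> J" "\<alpha> < \<infinity>"
  shows "\<exists>c N. 0 < c \<and> 0 < N \<and> (\<forall>k\<ge>N. c * real k powr (- 1 - real_of_ereal \<alpha>) \<le> (\<Sum>m\<in>l1_sphere k. J m))"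
proof -
  obtain \<eta> R c\<^sub>m where \<eta>: "tail_envelope CARD('d) \<alpha> \<eta>" and cm: "0 < c\<^sub>m"
    and J: "\<And>k. R \<le> real k \<Longrightarrow> c\<^sub>m * real k ^ (CARD('d) - 1) * \<eta> k \<le> (\<Sum>m\<in>l1_sphere k. J m)"
    using assms(1) unfolding admissible_kernel_def by blast
  from \<eta> assms(2) obtain C k\<^sub>0 where C: "0 < C" 
      "\<And>k. k \<ge> k\<^sub>0 \<Longrightarrow> C \<le> real k powr (real CARD('d) + real_of_ereal \<alpha>) * \<eta> k"
    unfolding tail_envelope_def by blast
  define N where "N = max (max 1 k\<^sub>0) (nat \<lceil>R\<rceil>)"
  have "c\<^sub>m * C * real k powr (- 1 - real_of_ereal \<alpha>) \<le> (\<Sum>m\<in>l1_sphere k. J m)" if k: "N \<le> k" for k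
  proof -
    have k0: "0 < k" using k by (simp add: N_def)
    have split: "real k powr (- 1 - real_of_ereal \<alpha>)
      = real k ^ (CARD('d) - 1) * real k powr - (real CARD('d) + real_of_ereal \<alpha>)"
      using k0 by (subst powr_realpow[symmetric]) (auto simp: of_nat_diff Suc_leI simp flip: powr_add)
    have "C * real k powr - (real CARD('d) + real_of_ereal \<alpha>) \<le> \<eta> k"
      using C(2)[of k] k k0 by (simp only: powr_minus) (simp add: N_def field_simps)
    then have "c\<^sub>m * real k ^ (CARD('d) - 1) * (C * real k powr - (real CARD('d) + real_of_ereal \<alpha>))
        \<le> c\<^sub>m * real k ^ (CARD('d) - 1) * \<eta> k"
      using cm by (intro mult_left_mono) auto
    also have "\<dots> \<le> (\<Sum>m\<in>l1_sphere k. J m)" using k by (intro J) (simp add: N_def nat_le_iff ceiling_le_iff)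
    finally show ?thesis by (simp only: split) (simp only: mult_ac)
  qed
  then show ?thesis using cm C(1) by (intro exI[of _ "c\<^sub>m * C"] exI[of _ N]) (auto simp: N_def)
qed

lemma powr_decay_mono:
  fixes K :: real
  assumes "0 \<le> b" "0 < K" "K \<le> x"
  shows "x powr - b \<le> K powr - b"
  using assms by (intro powr_mono2') auto

text \<open>The shell has at most \<open>(5 * K) ^ d\<close> points, as
  \<open>4 * K + 1 \<le> 5 * K\<close>, and each carries at most
  \<open>C * K powr - (d + a)\<close>.\<close>

lemma shell_mass_le:
  fixes J :: "int ^ 'd \<Rightarrow> real" and a :: real
  assumes "0 \<le> a" "0 \<le> C" "0 < N" "N \<le> K"
    and J: "\<And>m. N \<le> l1_norm m \<Longrightarrow> J m \<le> C * real (l1_norm m) powr - (CARD('d) + a)"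
  shows "(\<Sum>m\<in>shell K. J m) \<le> C * 5 ^ CARD('d) * real K powr - a"
proof -
  have K: "1 \<le> real K" using assms by simp
  have "(\<Sum>m\<in>shell K. J m) \<le> (\<Sum>m\<in>(shell K :: (int ^ 'd) set). C * real K powr - (CARD('d) + a))"
  proof (rule sum_mono)
    fix m :: "int ^ 'd" assume m: "m \<in> shell K"
    then have "J m \<le> C * real (l1_norm m) powr - (CARD('d) + a)" using assms by (intro J) (auto simp: shell_def)
    also have "\<dots> \<le> C * real K powr - (CARD('d) + a)"
      using m assms by (intro mult_left_mono powr_decay_mono) (auto simp: shell_def)
    finally show "J m \<le> C * real K powr - (CARD('d) + a)" .
  qed
  also have "\<dots> = real (card (shell K :: (int ^ 'd) set)) * (C * real K powr - (CARD('d) + a))" by simp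
  also have "\<dots> \<le> (5 * real K) ^ CARD('d) * (C * real K powr - (CARD('d) + a))"
  proof (intro mult_right_mono)
    have "(4 * real K + 1) ^ CARD('d) \<le> (5 * real K) ^ CARD('d)" using K by (intro power_mono) auto
    with card_shell_le[where 'd = 'd, of K]
    show "real (card (shell K :: (int ^ 'd) set)) \<le> (5 * real K) ^ CARD('d)" by linarith
  qed (use assms in auto)
  also have "\<dots> = C * 5 ^ CARD('d) * (real K powr CARD('d) * real K powr - (CARD('d) + a))"
    using K by (subst powr_realpow) (auto simp: power_mult_distrib)
  also have "real K powr CARD('d) * real K powr - (CARD('d) + a) = real K powr - a"
    by (simp flip: powr_add)
  finally show ?thesis .
qed

text \<open>Extends the decay bound to every shell: the finitely many shells below the threshold are
  controlled by the total mass of \<open>J\<close>.\<close>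

lemma dyadic_shell_mass_le:
  fixes J :: "int ^ 'd \<Rightarrow> real" and a :: real
  assumes "0 \<le> a" "0 < C" "0 < N"
    and J: "\<And>m. N \<le> l1_norm m \<Longrightarrow> J m \<le> C * real (l1_norm m) powr - (CARD('d) + a)"
    and nonneg: "\<And>m. 0 \<le> J m" and summ: "J summable_on UNIV"
  shows "\<exists>D>0. \<forall>i. (\<Sum>m\<in>shell (2 ^ i). J m) \<le> D * (2 powr - a) ^ i"
proof (intro exI conjI allI)
  define q :: real where "q = 2 powr - a"
  have q: "0 < q" "q \<le> 1" using assms(1) by (auto simp: q_def powr_minus divide_simps ge_one_powr_ge_zero)
  \<comment> \<open>The second term serves the shells with \<open>2 ^ i < N\<close>, where
    \<open>i \<le> N\<close> and hence \<open>q ^ N \<le> q ^ i\<close>.\<close>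
  define D where "D = C * 5 ^ CARD('d) + infsum J UNIV / q ^ N"
  have inf: "0 \<le> infsum J UNIV" using nonneg by (intro infsum_nonneg) auto
  show "0 < D" using assms(2) q inf by (auto simp: D_def intro!: add_pos_nonneg)
  fix i
  show "(\<Sum>m\<in>shell (2 ^ i). J m) \<le> D * (2 powr - a) ^ i"
  proof (cases "N \<le> 2 ^ i")
    case True
    have "(\<Sum>m\<in>shell (2 ^ i). J m) \<le> C * 5 ^ CARD('d) * q ^ i"
      using shell_mass_le[OF assms(1) _ assms(3) True J] assms(2) by (simp add: dyadic_powr q_def)
    also have "\<dots> \<le> D * q ^ i"
      using q inf by (intro mult_right_mono) (auto simp: D_def)
    finally show ?thesis by (simp add: q_def)
  next
    case False
    then have "i \<le> N" using less_exp[of i] by linarith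
    then have "q ^ N \<le> q ^ i" using q by (intro power_decreasing) auto
    have "(\<Sum>m\<in>shell (2 ^ i). J m) \<le> infsum J UNIV"
      using nonneg by (intro finite_sum_le_infsum summ finite_shell) auto
    also have "\<dots> = infsum J UNIV / q ^ N * q ^ N" using q by simp
    also have "\<dots> \<le> infsum J UNIV / q ^ N * q ^ i"
      using q inf \<open>q ^ N \<le> q ^ i\<close> by (intro mult_left_mono) auto
    also have "\<dots> \<le> D * q ^ i"
      using q assms(2) by (intro mult_right_mono) (auto simp: D_def)
    finally show ?thesis by (simp add: q_def)
  qed
qed

section \<open>Lower bounds for shell mass, away from hyperplanes\<close>

text \<open>The shell consists of \<open>K\<close> spheres of radius below \<open>2 * K\<close>,
  each of mass at least \<open>c * (2 * K) powr (- 1 - a)\<close>.\<close>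

lemma shell_mass_ge:
  fixes J :: "int ^ 'd \<Rightarrow> real" and a :: real
  assumes "0 \<le> a" "0 \<le> c" "0 < N" "N \<le> K"
    and J: "\<And>k. N \<le> k \<Longrightarrow> c * real k powr (- 1 - a) \<le> (\<Sum>m\<in>l1_sphere k. J m)"
  shows "c * 2 powr (- 1 - a) * real K powr - a \<le> (\<Sum>m\<in>shell K. J m)"
proof -
  have K: "0 < real K" using assms by simp
  have "c * 2 powr (- 1 - a) * real K powr - a = (\<Sum>k\<in>{K..<2*K}. c * (2 * real K) powr (- 1 - a))"
    using K by (simp add: powr_mult powr_diff powr_minus field_simps)
  also have "\<dots> \<le> (\<Sum>k\<in>{K..<2*K}. \<Sum>m\<in>l1_sphere k. J m)"
  proof (rule sum_mono)
    fix k assume k: "k \<in> {K..<2*K}"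
    then have "c * (2 * real K) powr (- 1 - a) \<le> c * real k powr (- 1 - a)"
      using assms K by (intro mult_left_mono powr_mono2') auto
    also have "\<dots> \<le> (\<Sum>m\<in>l1_sphere k. J m)" using k assms by (intro J) auto
    finally show "c * (2 * real K) powr (- 1 - a) \<le> (\<Sum>m\<in>l1_sphere k. J m)" .
  qed
  finally show ?thesis by (simp add: sum_shell)
qed

text \<open>The slab where \<open>lattice_inner m \<xi>\<close> is small takes at most half of the
  guaranteed mass of the shell; off the slab the squared inner product is at least
  \<open>(e * K * norm \<xi>)\<^sup>2\<close>. The constants are uniform in \<xi>.\<close>

lemma shell_quadratic_mass_ge:
  fixes J :: "int ^ 'd \<Rightarrow> real" and a :: real
  assumes a: "0 \<le> a" and C: "0 < C" and c: "0 < c" and N: "0 < N"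
    and upper: "\<And>m. N \<le> l1_norm m \<Longrightarrow> J m \<le> C * real (l1_norm m) powr - (CARD('d) + a)"
    and lower: "\<And>k. N \<le> k \<Longrightarrow> c * real k powr (- 1 - a) \<le> (\<Sum>m\<in>l1_sphere k. J m)"
    and nonneg: "\<And>m. 0 \<le> J m"
  shows "\<exists>c' N'. 0 < c' \<and> (\<forall>K\<ge>N'. \<forall>\<xi>. c' * real K powr (2 - a) * (norm \<xi>)\<^sup>2
    \<le> (\<Sum>m\<in>shell K. J m * (lattice_inner m \<xi>)\<^sup>2))"
proof -
  define d where "d = CARD('d)"
  have d: "1 \<le> d" unfolding d_def by (simp add: Suc_leI)
  define c1 where "c1 = c * 2 powr (- 1 - a)"
  have c1: "0 < c1" using c by (simp add: c1_def)
  \<comment> \<open>Solves \<open>C * 5 ^ (d - 1) * (3 * d * e) = c1 / 2\<close>, the left side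
    being the constant in the bound for the slab's mass.\<close>
  define e where "e = c1 / (6 * d * C * 5 ^ (d - 1))"
  have e: "0 < e" using c1 C d by (simp add: e_def)
  \<comment> \<open>Ensures \<open>1 \<le> d * e * K\<close>, so the additive 1 in the slab count is
    absorbed: \<open>1 + 2 * d * e * K \<le> 3 * d * e * K\<close>.\<close>
  define N' where "N' = max N (nat \<lceil>1 / (d * e)\<rceil>)"
  have "c1 / 2 * e\<^sup>2 * real K powr (2 - a) * (norm \<xi>)\<^sup>2 \<le> (\<Sum>m\<in>shell K. J m * (lattice_inner m \<xi>)\<^sup>2)"
    if KN: "N' \<le> K" for K \<xi>
  proof (cases "\<xi> = 0")
    case True
    then show ?thesis by (simp add: nonneg sum_nonneg)
  next
    case False
    have K: "1 \<le> real K" "N \<le> K" "1 / (d * e) \<le> real K"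
      using KN N by (auto simp: N'_def le_nat_iff intro: order_trans[OF real_nat_ceiling_ge])
    then have Kde: "1 \<le> d * e * real K" using d e by (simp add: field_simps)
    define b where "b = {m \<in> shell K. \<bar>lattice_inner m \<xi>\<bar> \<le> e * real K * norm \<xi>}"
    have b: "b \<subseteq> shell K" "finite b" unfolding b_def using finite_shell[of K] by auto
    have "(\<Sum>m\<in>b. J m) \<le> (\<Sum>m\<in>b. C * real K powr - (d + a))"
    proof (rule sum_mono)
      fix m assume m: "m \<in> b"
      then have "J m \<le> C * real (l1_norm m) powr - (d + a)"
        using K b unfolding d_def by (intro upper) (auto simp: shell_def)
      also have "\<dots> \<le> C * real K powr - (d + a)"
        using m b K a C by (intro mult_left_mono powr_decay_mono) (auto simp: shell_def)
      finally show "J m \<le> C * real K powr - (d + a)" .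
    qed
    also have "\<dots> = real (card b) * (C * real K powr - (d + a))" by simp
    also have "\<dots> \<le> ((5 * real K) ^ (d - 1) * (3 * d * e * real K)) * (C * real K powr - (d + a))"
    proof (rule mult_right_mono)
      have "real (card b) \<le> (4 * real K + 1) ^ (d - 1) * (1 + 2 * d * (e * real K))"
        unfolding b_def d_def using False e by (intro card_near_hyperplane_le) auto
      also have "\<dots> \<le> (5 * real K) ^ (d - 1) * (3 * d * e * real K)"
        using K Kde e by (intro mult_mono power_mono) (auto simp: algebra_simps)
      finally show "real (card b) \<le> (5 * real K) ^ (d - 1) * (3 * d * e * real K)" .
    qed (use C in auto)
    also have "\<dots> = C * 5 ^ (d - 1) * (3 * d * e) * (real K ^ Suc (d - 1) * real K powr - (d + a))"
      by (simp add: power_mult_distrib)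
    also have "real K ^ Suc (d - 1) * real K powr - (d + a) = real K powr - a"
      using K d by (subst powr_realpow[symmetric]) (auto simp flip: powr_add)
    also have "C * 5 ^ (d - 1) * (3 * d * e) = c1 / 2" using C d by (simp add: e_def field_simps)
    finally have bad: "(\<Sum>m\<in>b. J m) \<le> c1 / 2 * real K powr - a" .
    have "c1 * real K powr - a \<le> (\<Sum>m\<in>shell K. J m)"
      unfolding c1_def using c by (intro shell_mass_ge[OF a _ N K(2) lower]) auto
    also have "\<dots> = (\<Sum>m\<in>b. J m) + (\<Sum>m\<in>shell K - b. J m)"
      using b(1) finite_shell[of K] by (subst sum.subset_diff[OF b(1)]) (auto simp: add_ac)
    finally have good: "c1 / 2 * real K powr - a \<le> (\<Sum>m\<in>shell K - b. J m)" using bad by linarith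
    have "c1 / 2 * e\<^sup>2 * real K powr (2 - a) * (norm \<xi>)\<^sup>2
        = (c1 / 2 * real K powr - a) * (e * real K * norm \<xi>)\<^sup>2"
      using K by (simp add: power_mult_distrib powr_diff powr_minus field_simps)
    also have "\<dots> \<le> (\<Sum>m\<in>shell K - b. J m) * (e * real K * norm \<xi>)\<^sup>2"
      by (intro mult_right_mono good) auto
    also have "\<dots> \<le> (\<Sum>m\<in>shell K - b. J m * (lattice_inner m \<xi>)\<^sup>2)"
      unfolding sum_distrib_right
    proof (intro sum_mono mult_left_mono nonneg)
      fix m assume "m \<in> shell K - b"
      then have "e * real K * norm \<xi> \<le> \<bar>lattice_inner m \<xi>\<bar>" by (auto simp: b_def)
      then show "(e * real K * norm \<xi>)\<^sup>2 \<le> (lattice_inner m \<xi>)\<^sup>2"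
        using e power_mono[of "e * real K * norm \<xi>" "\<bar>lattice_inner m \<xi>\<bar>" 2] by simp
    qed
    also have "\<dots> \<le> (\<Sum>m\<in>shell K. J m * (lattice_inner m \<xi>)\<^sup>2)"
      by (intro sum_mono2 finite_shell) (auto intro!: mult_nonneg_nonneg nonneg)
    finally show ?thesis .
  qed
  moreover have "0 < c1 / 2 * e\<^sup>2" using c1 e by simp
  ultimately show ?thesis by blast
qed

subsection \<open>The symbol as a sum over shells\<close>

lemma symbol_summable:
  assumes "\<And>m. 0 \<le> J m" "J summable_on UNIV"
  shows "(\<lambda>m. J m * (sin (lattice_inner m \<xi> / 2))\<^sup>2) summable_on UNIV - {0}"
proof (rule summable_on_comparison_test[where f = J])
  show "J summable_on UNIV - {0}" using assms(2) by (rule summable_on_subset_banach) auto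
  show "J m * (sin (lattice_inner m \<xi> / 2))\<^sup>2 \<le> J m" for m
    using assms(1)[of m] by (intro mult_right_le_one_le) (auto simp: power2_le_iff_abs_le abs_square_le_1)
qed (use assms(1) in auto)

lemma symbol_eq: "symbol J \<xi> = 2 * (\<Sum>\<^sub>\<infinity>m\<in>UNIV - {0}. J m * (sin (lattice_inner m \<xi> / 2))\<^sup>2)"
  by (simp add: symbol_def lattice_inner_def)

lemma symbol_ge_finite_sum:
  assumes "\<And>m. 0 \<le> J m" "J summable_on UNIV" "finite F" "0 \<notin> F"
  shows "2 * (\<Sum>m\<in>F. J m * (sin (lattice_inner m \<xi> / 2))\<^sup>2) \<le> symbol J \<xi>"
  unfolding symbol_eq
  by (intro mult_left_mono finite_sum_le_infsum symbol_summable) (use assms in auto)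

lemma zero_notin_shell: "0 < K \<Longrightarrow> 0 \<notin> shell K"
  by (simp add: shell_def l1_norm_def)

lemma symbol_ge_shell_sums:
  assumes "\<And>m. 0 \<le> J m" "J summable_on UNIV" "finite I"
  shows "2 * (\<Sum>i\<in>I. \<Sum>m\<in>shell (2 ^ i). J m * (sin (lattice_inner m \<xi> / 2))\<^sup>2) \<le> symbol J \<xi>"
proof -
  have "(\<Sum>i\<in>I. \<Sum>m\<in>shell (2 ^ i). J m * (sin (lattice_inner m \<xi> / 2))\<^sup>2)
      = (\<Sum>m\<in>(\<Union>i\<in>I. shell (2 ^ i)). J m * (sin (lattice_inner m \<xi> / 2))\<^sup>2)"
    using disjoint_dyadic_shells[of I] assms(3)
    by (subst sum.UNION_disjoint) (auto simp: finite_shell disjoint_family_on_def)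
  then show ?thesis
    using symbol_ge_finite_sum[OF assms(1,2), where F = "\<Union>i\<in>I. shell (2 ^ i)" and \<xi> = \<xi>] assms(3)
    by (simp add: finite_shell zero_notin_shell)
qed

text \<open>Every finite set of nonzero lattice points is covered by finitely many dyadic shells, so
  a bound uniform in their number passes to the infinite sum.\<close>

lemma symbol_le_shell_sums:
  assumes "\<And>m. 0 \<le> J m" "J summable_on UNIV"
    and bound: "\<And>N. (\<Sum>i<N. \<Sum>m\<in>shell (2 ^ i). J m * (sin (lattice_inner m \<xi> / 2))\<^sup>2) \<le> B"
  shows "symbol J \<xi> \<le> 2 * B"
  unfolding symbol_eq
proof (intro mult_left_mono infsum_le_finite_sums symbol_summable assms)
  fix F assume F: "finite F" "F \<subseteq> UNIV - {0 :: int ^ 'a}"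
  let ?f = "\<lambda>m. J m * (sin (lattice_inner m \<xi> / 2))\<^sup>2"
  have "\<forall>m\<in>F. \<exists>i. m \<in> shell (2 ^ i)" using F dyadic_shell_exists by blast
  then obtain g where g: "\<And>m. m \<in> F \<Longrightarrow> m \<in> shell (2 ^ g m)" by metis
  have fin: "finite (g ` F)" using F by simp
  define N where "N = Suc (Max (g ` F))"
  have "F \<subseteq> (\<Union>i<N. shell (2 ^ i))"
  proof
    fix m assume "m \<in> F"
    then have "g m < N" using Max_ge[OF fin, of "g m"] by (simp add: N_def)
    then show "m \<in> (\<Union>i<N. shell (2 ^ i))" using g[OF \<open>m \<in> F\<close>] by blast
  qed
  then have "sum ?f F \<le> sum ?f (\<Union>i<N. shell (2 ^ i))"
    by (intro sum_mono2) (auto simp: finite_shell assms(1))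
  also have "\<dots> = (\<Sum>i<N. sum ?f (shell (2 ^ i)))"
    using disjoint_dyadic_shells[of "{..<N}"]
    by (subst sum.UNION_disjoint) (auto simp: finite_shell disjoint_family_on_def)
  also have "\<dots> \<le> B" by (rule bound)
  finally show "sum ?f F \<le> B" .
qed auto

text \<open>Combines \<open>\<bar>sin x\<bar> \<le> 1\<close> and
  \<open>\<bar>sin x\<bar> \<le> \<bar>x\<bar>\<close>; the half angle cancels the factor 2 in the
  outer radius \<open>2 * 2 ^ i\<close>.\<close>

lemma shell_sin_le:
  assumes "\<And>m. 0 \<le> J m"
  shows "(\<Sum>m\<in>shell (2 ^ i). J m * (sin (lattice_inner m \<xi> / 2))\<^sup>2)
    \<le> (\<Sum>m\<in>shell (2 ^ i). J m) * min 1 (4 ^ i * (norm \<xi>)\<^sup>2)"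
  unfolding sum_distrib_right
proof (intro sum_mono mult_left_mono assms)
  fix m :: "int ^ 'a" assume m: "m \<in> shell (2 ^ i)"
  let ?s = "sin (lattice_inner m \<xi> / 2)"
  have "\<bar>?s\<bar> \<le> \<bar>lattice_inner m \<xi> / 2\<bar>" by (rule abs_sin_x_le_abs_x)
  also have "\<dots> \<le> real (l1_norm m) * norm \<xi> / 2" using abs_lattice_inner_le[of m \<xi>] by simp
  also have "\<dots> \<le> 2 ^ i * norm \<xi>"
  proof -
    have "l1_norm m \<le> 2 * 2 ^ i" using m by (simp add: shell_def)
    then have "real (l1_norm m) \<le> 2 * 2 ^ i" by (metis of_nat_le_iff of_nat_mult of_nat_numeral of_nat_power)
    from mult_right_mono[OF this norm_ge_zero[of \<xi>]] show ?thesis by simp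
  qed
  finally have "\<bar>?s\<bar>\<^sup>2 \<le> (2 ^ i * norm \<xi>)\<^sup>2" by (intro power_mono) auto
  also have "\<dots> = 4 ^ i * (norm \<xi>)\<^sup>2"
    by (simp add: power_mult_distrib power_mult[symmetric] mult.commute[of i] power_mult)
  finally have "?s\<^sup>2 \<le> 4 ^ i * (norm \<xi>)\<^sup>2" by simp
  moreover have "?s\<^sup>2 \<le> 1" by (simp add: abs_square_le_1)
  ultimately show "?s\<^sup>2 \<le> min 1 (4 ^ i * (norm \<xi>)\<^sup>2)" by simp
qed

text \<open>The scale condition keeps the half angle within 1, hence within \<open>pi / 2\<close>,
  where Jordan's inequality applies.\<close>

lemma shell_sin_ge:
  assumes "\<And>m. 0 \<le> J m" "2 ^ i * norm \<xi> \<le> 1"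
  shows "(\<Sum>m\<in>shell (2 ^ i). J m * (lattice_inner m \<xi>)\<^sup>2) / pi\<^sup>2
    \<le> (\<Sum>m\<in>shell (2 ^ i). J m * (sin (lattice_inner m \<xi> / 2))\<^sup>2)"
  unfolding sum_divide_distrib times_divide_eq_right[symmetric]
proof (intro sum_mono mult_left_mono assms)
  fix m :: "int ^ 'a" assume m: "m \<in> shell (2 ^ i)"
  have "l1_norm m \<le> 2 * 2 ^ i" using m by (simp add: shell_def)
  then have "real (l1_norm m) \<le> 2 * 2 ^ i" by (metis of_nat_le_iff of_nat_mult of_nat_numeral of_nat_power)
  from mult_right_mono[OF this norm_ge_zero[of \<xi>]]
  have "\<bar>lattice_inner m \<xi> / 2\<bar> \<le> pi / 2"
    using abs_lattice_inner_le[of m \<xi>] assms(2) pi_gt3 by simp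
  from jordan_sin_sq[OF this] show "(lattice_inner m \<xi>)\<^sup>2 / pi\<^sup>2 \<le> (sin (lattice_inner m \<xi> / 2))\<^sup>2"
    by (simp add: power_divide)
qed

section \<open>Truncated geometric sums and their comparison with \<open>delta\<close>\<close>

text \<open>The cut \<open>I\<close> is free: below it the minimum is bounded by its quadratic
  entry, from it on by 1.\<close>

lemma sum_truncated_geometric_le:
  fixes q r :: real
  assumes "0 < q" "q < 1"
  shows "(\<Sum>i<N. q ^ i * min 1 (4 ^ i * r\<^sup>2)) \<le> (\<Sum>i<I. (4 * q) ^ i) * r\<^sup>2 + q ^ I / (1 - q)"
proof -
  \<comment> \<open>Lengthening the range allows a split at \<open>I\<close> even when
    \<open>N < I\<close>.\<close>
  have "(\<Sum>i<N. q ^ i * min 1 (4 ^ i * r\<^sup>2)) \<le> (\<Sum>i<I + N. q ^ i * min 1 (4 ^ i * r\<^sup>2))"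
    using assms by (intro sum_mono2) auto
  also have "\<dots> = (\<Sum>i<I. q ^ i * min 1 (4 ^ i * r\<^sup>2)) + (\<Sum>i<N. q ^ (I + i) * min 1 (4 ^ (I + i) * r\<^sup>2))"
    by (induction N) (auto simp: add_ac)
  also have "(\<Sum>i<I. q ^ i * min 1 (4 ^ i * r\<^sup>2)) \<le> (\<Sum>i<I. (4 * q) ^ i) * r\<^sup>2"
    unfolding sum_distrib_right
  proof (rule sum_mono)
    fix i
    have "q ^ i * min 1 (4 ^ i * r\<^sup>2) \<le> q ^ i * (4 ^ i * r\<^sup>2)" using assms by (intro mult_left_mono) auto
    then show "q ^ i * min 1 (4 ^ i * r\<^sup>2) \<le> (4 * q) ^ i * r\<^sup>2" by (simp add: power_mult_distrib mult_ac)
  qed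
  also have "(\<Sum>i<N. q ^ (I + i) * min 1 (4 ^ (I + i) * r\<^sup>2)) \<le> (\<Sum>i<N. q ^ I * q ^ i)"
  proof (rule sum_mono)
    fix i
    have "q ^ (I + i) * min 1 (4 ^ (I + i) * r\<^sup>2) \<le> q ^ (I + i) * 1" using assms by (intro mult_left_mono) auto
    then show "q ^ (I + i) * min 1 (4 ^ (I + i) * r\<^sup>2) \<le> q ^ I * q ^ i" by (simp add: power_add)
  qed
  also have "\<dots> = q ^ I * ((1 - q ^ N) / (1 - q))"
    using assms by (simp add: sum_gp_strict flip: sum_distrib_left)
  also have "\<dots> \<le> q ^ I * (1 / (1 - q))"
    using assms by (intro mult_left_mono divide_right_mono) auto
  finally show ?thesis by simp
qed

lemma dyadic_floor_exists:
  fixes y :: real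
  assumes "1 \<le> y"
  shows "\<exists>I. 2 ^ I \<le> y \<and> y < 2 ^ Suc I"
proof -
  have "1 \<le> nat \<lfloor>y\<rfloor>" using assms by (simp add: le_nat_iff)
  then obtain I where I: "2 ^ I \<le> nat \<lfloor>y\<rfloor>" "nat \<lfloor>y\<rfloor> < 2 ^ (I + 1)"
    using ex_power_ivl1[OF order_refl] by blast
  have "2 ^ I \<le> \<lfloor>y\<rfloor>" "\<lfloor>y\<rfloor> < 2 ^ Suc I"
    using I assms by (auto simp: le_nat_iff nat_less_iff)
  then show ?thesis by (auto simp: le_floor_iff floor_less_iff)
qed

lemma japanese_bracket_ge: "1 \<le> japanese_bracket z" "\<bar>z\<bar> \<le> japanese_bracket z"
  by (auto simp: japanese_bracket_def intro!: real_le_rsqrt)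

lemma japanese_bracket_le: "japanese_bracket z \<le> 1 + \<bar>z\<bar>"
  unfolding japanese_bracket_def by (rule real_le_lsqrt) (auto simp: power2_eq_square algebra_simps)

lemma delta_ereal:
  assumes "0 < r"
  shows "a < 2 \<Longrightarrow> delta (ereal a) r = r powr a"
    and "a = 2 \<Longrightarrow> delta (ereal a) r = r\<^sup>2 * japanese_bracket (ln r)"
    and "2 < a \<Longrightarrow> delta (ereal a) r = r\<^sup>2"
  using assms by (auto simp: delta_def alpha'_def)

lemma delta_infinity: "delta \<infinity> r = delta (ereal 3) r"
  by (simp add: delta_def alpha'_def)

text \<open>The head has ratio \<open>4 * q = 2 powr (2 - a)\<close>: it is dominated by its last
  term, counts its terms, or converges according as \<open>a\<close> is below, equal to or above 2,
  and these are the three regimes of \<open>delta\<close>. For \<open>a \<le> 2\<close> and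
  \<open>r \<le> 1\<close> the cut is at \<open>2 ^ I\<close> of order \<open>1 / r\<close>, which
  makes the tail of order \<open>r powr a\<close>.\<close>

lemma truncated_geometric_le_delta:
  fixes a :: real
  assumes a: "0 < a"
  shows "\<exists>D>0. \<forall>r>0. \<forall>N. (\<Sum>i<N. (2 powr - a) ^ i * min 1 (4 ^ i * r\<^sup>2)) \<le> D * delta (ereal a) r"
proof -
  define q :: real where "q = 2 powr - a"
  have q: "0 < q" "q < 1" using a by (auto simp: q_def powr_less_one)
  have q4: "4 * q = 2 powr (2 - a)" by (simp add: q_def powr_diff powr_minus divide_simps)
  \<comment> \<open>The cut at 0, used for \<open>r > 1\<close>, where the comparison function is at
    least 1.\<close>
  have crude: "(\<Sum>i<N. q ^ i * min 1 (4 ^ i * r\<^sup>2)) \<le> 1 / (1 - q)" for N r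
    using sum_truncated_geometric_le[OF q, of r N 0] by simp
  have qI: "q ^ I \<le> r powr a" if "0 < r" "1 / r \<le> 2 ^ I" for r :: real and I
  proof -
    have "(2 ^ I) powr - a \<le> (1 / r) powr - a" using that a by (intro powr_decay_mono) auto
    also have "\<dots> = r powr a" using that by (simp add: powr_divide powr_minus)
    finally show ?thesis by (simp add: dyadic_powr q_def)
  qed
  have scale: "\<exists>I. 1 / r \<le> 2 ^ I \<and> 2 ^ I \<le> 2 / r" if r: "0 < r" "r \<le> 1" for r :: real
  proof -
    obtain I where "2 ^ I \<le> 2 / r" "2 / r < 2 ^ Suc I"
      \<comment> \<open>Rounding \<open>2 / r\<close> down to a power of 2 leaves at least
        \<open>1 / r\<close>, as the tail estimate demands.\<close>
      using dyadic_floor_exists[of "2 / r"] r by auto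
    then show ?thesis by (intro exI[of _ I]) auto
  qed
  consider "a < 2" | "a = 2" | "2 < a" by linarith
  then have "\<exists>D>0. \<forall>r>0. \<forall>N. (\<Sum>i<N. q ^ i * min 1 (4 ^ i * r\<^sup>2)) \<le> D * delta (ereal a) r"
  proof cases
    case 1
    have Q: "1 < 4 * q" using 1 by (simp add: q4)
    define D where "D = 2 powr (2 - a) / (4 * q - 1) + 1 / (1 - q)"
    have D: "1 / (1 - q) \<le> D" "0 < D" using q Q by (auto simp: D_def intro!: add_pos_pos)
    have "(\<Sum>i<N. q ^ i * min 1 (4 ^ i * r\<^sup>2)) \<le> D * r powr a" if r: "0 < r" for r N
    proof (cases "r \<le> 1")
      case True
      obtain I where I: "1 / r \<le> 2 ^ I" "2 ^ I \<le> 2 / r" using scale[OF r True] by blast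
      have "(4 * q) ^ I = (2 ^ I) powr (2 - a)" by (simp add: q4 dyadic_powr)
      also have "\<dots> \<le> (2 / r) powr (2 - a)" using I 1 by (intro powr_mono2) auto
      finally have "(4 * q) ^ I * r\<^sup>2 \<le> (2 / r) powr (2 - a) * r\<^sup>2" by (intro mult_right_mono) auto
      also have "\<dots> = 2 powr (2 - a) * r powr a"
        using r by (simp add: powr_divide powr_diff field_simps power2_eq_square)
      finally have *: "(4 * q) ^ I * r\<^sup>2 \<le> 2 powr (2 - a) * r powr a" .
      have "(\<Sum>i<I. (4 * q) ^ i) = ((4 * q) ^ I - 1) / (4 * q - 1)"
        using Q by (subst geometric_sum) auto
      also have "\<dots> \<le> (4 * q) ^ I / (4 * q - 1)" using Q by (intro divide_right_mono) auto
      finally have "(\<Sum>i<I. (4 * q) ^ i) * r\<^sup>2 \<le> (4 * q) ^ I / (4 * q - 1) * r\<^sup>2"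
        by (intro mult_right_mono) auto
      also have "\<dots> \<le> 2 powr (2 - a) * r powr a / (4 * q - 1)"
        using divide_right_mono[OF *, of "4 * q - 1"] Q by simp
      finally show ?thesis
        using sum_truncated_geometric_le[OF q, of r N I] divide_right_mono[OF qI[OF r I(1)], of "1 - q"] q
        by (simp add: D_def distrib_right)
    next
      case False
      then have "1 \<le> r powr a" using a by (intro ge_one_powr_ge_zero) auto
      with D have "1 / (1 - q) * 1 \<le> D * r powr a" by (intro mult_mono) auto
      with crude[where r = r and N = N] show ?thesis by simp
    qed
    then show ?thesis using D(2) 1 by (intro exI[of _ D]) (auto simp: delta_ereal)
  next
    case 2
    then have q2: "q = 1 / 4" by (simp add: q_def powr_minus)
    have "(\<Sum>i<N. q ^ i * min 1 (4 ^ i * r\<^sup>2)) \<le> 5 * (r\<^sup>2 * japanese_bracket (ln r))" if r: "0 < r" for r N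
    proof (cases "r \<le> 1")
      case True
      obtain I where I: "1 / r \<le> 2 ^ I" "2 ^ I \<le> 2 / r" using scale[OF r True] by blast
      \<comment> \<open>The number of head terms is at most the binary logarithm of
        \<open>2 / r\<close>; \<open>1 / 2 \<le> ln 2\<close> turns it into a natural one.\<close>
      have "real I * ln 2 = ln (2 ^ I)" by (simp add: ln_realpow)
      also have "\<dots> \<le> ln (2 / r)" using I(2) r by (subst ln_le_cancel_iff) auto
      also have "\<dots> = ln 2 + \<bar>ln r\<bar>" using r True by (simp add: ln_div)
      finally have "real I * ln 2 \<le> ln 2 + \<bar>ln r\<bar>" .
      moreover have "1 / 2 \<le> ln (2::real)" using ln2_ge_two_thirds by simp
      then have "\<bar>ln r\<bar> * 1 \<le> \<bar>ln r\<bar> * (2 * ln 2)" by (intro mult_left_mono) auto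
      ultimately have "real I * ln 2 \<le> (1 + 2 * \<bar>ln r\<bar>) * ln 2" by (simp add: algebra_simps)
      then have "real I \<le> 1 + 2 * \<bar>ln r\<bar>" by simp
      \<comment> \<open>The tail constant \<open>1 / (1 - q)\<close> is \<open>4 / 3\<close> at
        \<open>q = 1 / 4\<close>, and \<open>1 + 2 + 4 / 3 \<le> 5\<close>.\<close>
      then have I3: "real I + 4 / 3 \<le> 5 * japanese_bracket (ln r)"
        using japanese_bracket_ge[of "ln r"] by linarith
      have "q ^ I \<le> r\<^sup>2" using qI[OF r I(1)] 2 r by simp
      then have "(\<Sum>i<N. q ^ i * min 1 (4 ^ i * r\<^sup>2)) \<le> real I * r\<^sup>2 + r\<^sup>2 * (4 / 3)"
        using sum_truncated_geometric_le[OF q, of r N I] by (simp add: q2)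
      also have "\<dots> = r\<^sup>2 * (real I + 4 / 3)" by (simp add: algebra_simps)
      also have "\<dots> \<le> r\<^sup>2 * (5 * japanese_bracket (ln r))" using I3 by (intro mult_left_mono) auto
      finally show ?thesis by (simp add: mult_ac)
    next
      case False
      then have "1 \<le> r\<^sup>2" by simp
      then have "1 * 1 \<le> r\<^sup>2 * japanese_bracket (ln r)" 
        using japanese_bracket_ge[of "ln r"] by (intro mult_mono) auto
      with crude[where r = r and N = N] show ?thesis by (simp add: q2)
    qed
    then show ?thesis using 2 by (intro exI[of _ 5]) (auto simp: delta_ereal)
  next
    case 3
    have Q: "4 * q < 1" using 3 by (simp add: q4 powr_less_one)
    \<comment> \<open>Here the quadratic bound is itself summable over all shells.\<close>
    have "(\<Sum>i<N. q ^ i * min 1 (4 ^ i * r\<^sup>2)) \<le> 1 / (1 - 4 * q) * r\<^sup>2" for r N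
    proof -
      have "(\<Sum>i<N. q ^ i * min 1 (4 ^ i * r\<^sup>2)) \<le> (\<Sum>i<N. (4 * q) ^ i * r\<^sup>2)"
      proof (rule sum_mono)
        fix i
        have "q ^ i * min 1 (4 ^ i * r\<^sup>2) \<le> q ^ i * (4 ^ i * r\<^sup>2)" using q by (intro mult_left_mono) auto
        then show "q ^ i * min 1 (4 ^ i * r\<^sup>2) \<le> (4 * q) ^ i * r\<^sup>2" by (simp add: power_mult_distrib mult_ac)
      qed
      also have "\<dots> = (1 - (4 * q) ^ N) / (1 - 4 * q) * r\<^sup>2"
        unfolding sum_distrib_right[symmetric] sum_gp_strict using Q by simp
      also have "\<dots> \<le> 1 / (1 - 4 * q) * r\<^sup>2"
        using q Q by (intro mult_right_mono divide_right_mono) auto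
      finally show ?thesis .
    qed
    then show ?thesis using 3 Q by (intro exI[of _ "1 / (1 - 4 * q)"]) (auto simp: delta_ereal)
  qed
  then show ?thesis by (simp add: q_def)
qed

subsection \<open>Two-sided bound\<close>

text \<open>Shell by shell, the mass bound times the sine bound gives the truncated geometric sum.
  Both sine bounds are global, so the estimate covers all real \<xi>.\<close>

lemma symbol_upper:
  fixes J :: "int ^ 'd \<Rightarrow> real"
  assumes "admissible_kernel \<alpha> J"
  shows "\<exists>C>0. \<forall>\<xi>. symbol J \<xi> \<le> C * delta \<alpha> (norm \<xi>)"
proof -
  define a where "a = (if \<alpha> = \<infinity> then 3 else real_of_ereal \<alpha>)"
  have \<alpha>: "0 < \<alpha>" and nonneg: "\<And>n. 0 \<le> J n" and summ: "J summable_on UNIV"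
    using assms unfolding admissible_kernel_def by auto
  have a: "0 < a" "delta \<alpha> r = delta (ereal a) r" for r
    using \<alpha> by (cases \<alpha>; simp add: a_def delta_infinity)+
  obtain C N where "0 < C" "0 < N"
    "\<And>m. N \<le> l1_norm m \<Longrightarrow> J m \<le> C * real (l1_norm m) powr - (CARD('d) + a)"
    using admissible_kernel_decay[OF assms a_def] by blast
  then obtain D where D: "0 < D" "\<And>i. (\<Sum>m\<in>shell (2 ^ i). J m) \<le> D * (2 powr - a) ^ i"
    using dyadic_shell_mass_le[of a C N J] a(1) nonneg summ by auto
  obtain E where E: "0 < E"
    "\<And>r N. 0 < r \<Longrightarrow> (\<Sum>i<N. (2 powr - a) ^ i * min 1 (4 ^ i * r\<^sup>2)) \<le> E * delta (ereal a) r"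
    using truncated_geometric_le_delta[OF a(1)] by blast
  have "symbol J \<xi> \<le> 2 * (D * E) * delta \<alpha> (norm \<xi>)" for \<xi> :: "real ^ 'd"
  proof (cases "\<xi> = 0")
    case True
    then show ?thesis by (simp add: symbol_def delta_def)
  next
    case False
    have "symbol J \<xi> \<le> 2 * (D * (E * delta (ereal a) (norm \<xi>)))"
    proof (rule symbol_le_shell_sums[OF nonneg summ])
      fix N
      have "(\<Sum>i<N. \<Sum>m\<in>shell (2 ^ i). J m * (sin (lattice_inner m \<xi> / 2))\<^sup>2)
          \<le> (\<Sum>i<N. D * ((2 powr - a) ^ i * min 1 (4 ^ i * (norm \<xi>)\<^sup>2)))"
      proof (rule sum_mono)
        fix i
        have "(\<Sum>m\<in>shell (2 ^ i). J m * (sin (lattice_inner m \<xi> / 2))\<^sup>2)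
            \<le> (\<Sum>m\<in>shell (2 ^ i). J m) * min 1 (4 ^ i * (norm \<xi>)\<^sup>2)"
          by (rule shell_sin_le[OF nonneg])
        also have "\<dots> \<le> D * (2 powr - a) ^ i * min 1 (4 ^ i * (norm \<xi>)\<^sup>2)"
          by (intro mult_right_mono D(2)) auto
        finally show "(\<Sum>m\<in>shell (2 ^ i). J m * (sin (lattice_inner m \<xi> / 2))\<^sup>2)
          \<le> D * ((2 powr - a) ^ i * min 1 (4 ^ i * (norm \<xi>)\<^sup>2))" by (simp only: mult.assoc)
      qed
      also have "\<dots> = D * (\<Sum>i<N. (2 powr - a) ^ i * min 1 (4 ^ i * (norm \<xi>)\<^sup>2))"
        by (rule sum_distrib_left[symmetric])
      also have "\<dots> \<le> D * (E * delta (ereal a) (norm \<xi>))"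
        using D(1) False by (intro mult_left_mono E(2)) auto
      finally show "(\<Sum>i<N. \<Sum>m\<in>shell (2 ^ i). J m * (sin (lattice_inner m \<xi> / 2))\<^sup>2)
        \<le> D * (E * delta (ereal a) (norm \<xi>))" .
    qed
    then show ?thesis by (simp add: a(2) mult_ac)
  qed
  then show ?thesis using D(1) E(1) by (intro exI[of _ "2 * (D * E)"]) auto
qed

section \<open>Lower bound for the symbol\<close>

text \<open>The positive unit vectors alone suffice: by condition (II) each has weight at least the
  minimum, and on the torus \<open>\<bar>\<xi> $ i / 2\<bar> \<le> pi / 2\<close>, the range of
  Jordan's inequality.\<close>

lemma symbol_ge_quadratic:
  fixes J :: "int ^ 'd \<Rightarrow> real"
  assumes "\<And>m. 0 \<le> J m" "J summable_on UNIV" "0 < Min (J ` l1_sphere 1)"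
  shows "\<exists>c>0. \<forall>\<xi>\<in>torus. c * (norm \<xi>)\<^sup>2 \<le> symbol J \<xi>"
proof -
  define \<mu> where "\<mu> = Min (J ` l1_sphere 1)"
  have "2 * \<mu> / pi\<^sup>2 * (norm \<xi>)\<^sup>2 \<le> symbol J \<xi>" if \<xi>: "\<xi> \<in> torus" for \<xi> :: "real ^ 'd"
  proof -
    define F where "F = range (\<lambda>i::'d. axis i (1::int))"
    have inj: "inj (\<lambda>i::'d. axis i (1::int))" by (auto simp: inj_on_def axis_eq_axis)
    have norm: "l1_norm (axis i (1::int) :: int ^ 'd) = 1" for i
      by (simp add: l1_norm_def axis_def if_distrib cong: if_cong)
    have inner: "lattice_inner (axis i 1) \<xi> = \<xi> $ i" for i
      by (simp add: lattice_inner_def axis_def if_distrib[of of_int] if_distrib[of "\<lambda>x. x * _"] cong: if_cong)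
    have J: "\<mu> \<le> J (axis i 1)" for i
      unfolding \<mu>_def using norm by (intro Min_le finite_imageI finite_l1_sphere imageI) (simp add: l1_sphere_def)
    have "(norm \<xi>)\<^sup>2 = (\<Sum>i\<in>UNIV. (\<xi> $ i)\<^sup>2)"
      by (simp add: norm_vec_def L2_set_def sum_nonneg)
    then have "\<mu> / pi\<^sup>2 * (norm \<xi>)\<^sup>2 = (\<Sum>i\<in>UNIV. \<mu> * ((\<xi> $ i)\<^sup>2 / pi\<^sup>2))"
      by (simp add: sum_distrib_left)
    also have "\<dots> \<le> (\<Sum>i\<in>UNIV. J (axis i 1) * (sin (\<xi> $ i / 2))\<^sup>2)"
    proof (intro sum_mono mult_mono J assms)
      fix i
      have "- pi < \<xi> $ i" "\<xi> $ i \<le> pi" using \<xi> by (auto simp: torus_def)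
      then have "\<bar>\<xi> $ i / 2\<bar> \<le> pi / 2" by auto
      from jordan_sin_sq[OF this] show "(\<xi> $ i)\<^sup>2 / pi\<^sup>2 \<le> (sin (\<xi> $ i / 2))\<^sup>2"
        by (simp add: power_divide)
    qed auto
    also have "\<dots> = (\<Sum>m\<in>F. J m * (sin (lattice_inner m \<xi> / 2))\<^sup>2)"
      unfolding F_def by (subst sum.reindex[OF inj]) (simp add: inner)
    finally have "\<mu> / pi\<^sup>2 * (norm \<xi>)\<^sup>2 \<le> (\<Sum>m\<in>F. J m * (sin (lattice_inner m \<xi> / 2))\<^sup>2)" .
    moreover have "0 \<notin> F" using norm by (auto simp: F_def axis_eq_0_iff)
    ultimately show ?thesis
      using symbol_ge_finite_sum[OF assms(1,2), of F \<xi>] by (simp add: F_def)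
  qed
  moreover have "0 < 2 * \<mu> / pi\<^sup>2" using assms(3) by (simp add: \<mu>_def)
  ultimately show ?thesis by blast
qed

text \<open>Keeps the set \<open>I\<close> of shells free: a single shell near scale
  \<open>1 / norm \<xi>\<close> serves \<alpha> below 2, a whole range of shells serves \<alpha> =
  2.\<close>

lemma symbol_ge_dyadic_sum:
  fixes J :: "int ^ 'd \<Rightarrow> real"
  assumes "admissible_kernel (ereal a) J"
  obtains c i\<^sub>0 where "0 < c"
    and "\<forall>\<xi> I. finite I \<longrightarrow> (\<forall>i\<in>I. i\<^sub>0 \<le> i \<and> 2 ^ i * norm \<xi> \<le> 1)
      \<longrightarrow> (\<Sum>i\<in>I. c * (2 ^ i) powr (2 - a) * (norm \<xi>)\<^sup>2) \<le> symbol J \<xi>"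
proof -
  have a: "0 < a" and nonneg: "\<And>n. 0 \<le> J n" and summ: "J summable_on UNIV"
    using assms unfolding admissible_kernel_def by auto
  obtain C N where C: "0 < C" "0 < N"
    "\<And>m. N \<le> l1_norm m \<Longrightarrow> J m \<le> C * real (l1_norm m) powr - (CARD('d) + a)"
    using admissible_kernel_decay[OF assms, of a] by auto
  obtain c M where c: "0 < c" "0 < M"
    "\<And>k. M \<le> k \<Longrightarrow> c * real k powr (- 1 - a) \<le> (\<Sum>m\<in>l1_sphere k. J m)"
    using admissible_kernel_sphere_mass[OF assms] by auto
  have "\<exists>c' N'. 0 < c' \<and> (\<forall>K\<ge>N'. \<forall>\<xi>. c' * real K powr (2 - a) * (norm \<xi>)\<^sup>2
      \<le> (\<Sum>m\<in>shell K. J m * (lattice_inner m \<xi>)\<^sup>2))"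
    by (rule shell_quadratic_mass_ge[of a C c "max N M" J]) (use a nonneg C c in auto)
  then obtain c' N' where c': "0 < c'"
    "\<And>K \<xi>. N' \<le> K \<Longrightarrow> c' * real K powr (2 - a) * (norm \<xi>)\<^sup>2
      \<le> (\<Sum>m\<in>shell K. J m * (lattice_inner m \<xi>)\<^sup>2)"
    by blast
  have "(\<Sum>i\<in>I. 2 * c' / pi\<^sup>2 * (2 ^ i) powr (2 - a) * (norm \<xi>)\<^sup>2) \<le> symbol J \<xi>"
    if I: "finite I" "\<And>i. i \<in> I \<Longrightarrow> N' \<le> i \<and> 2 ^ i * norm \<xi> \<le> 1" for \<xi> I
  proof -
    have "(\<Sum>i\<in>I. 2 * c' / pi\<^sup>2 * (2 ^ i) powr (2 - a) * (norm \<xi>)\<^sup>2)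
        = 2 * (\<Sum>i\<in>I. c' * (2 ^ i) powr (2 - a) * (norm \<xi>)\<^sup>2 / pi\<^sup>2)"
      by (simp add: sum_distrib_left mult_ac)
    also have "\<dots> \<le> 2 * (\<Sum>i\<in>I. \<Sum>m\<in>shell (2 ^ i). J m * (sin (lattice_inner m \<xi> / 2))\<^sup>2)"
    proof (intro mult_left_mono sum_mono)
      fix i assume i: "i \<in> I"
      \<comment> \<open>Since \<open>i < 2 ^ i\<close>, the radius threshold \<open>N'\<close> also
        works as an index threshold.\<close>
      then have "N' \<le> 2 ^ i" using I(2)[OF i] less_exp[of i] by linarith
      then have "c' * (2 ^ i) powr (2 - a) * (norm \<xi>)\<^sup>2 / pi\<^sup>2
          \<le> (\<Sum>m\<in>shell (2 ^ i). J m * (lattice_inner m \<xi>)\<^sup>2) / pi\<^sup>2"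
        using c'(2)[of "2 ^ i" \<xi>] by (intro divide_right_mono) auto
      also have "\<dots> \<le> (\<Sum>m\<in>shell (2 ^ i). J m * (sin (lattice_inner m \<xi> / 2))\<^sup>2)"
        using I(2)[OF i] by (intro shell_sin_ge nonneg) auto
      finally show "c' * (2 ^ i) powr (2 - a) * (norm \<xi>)\<^sup>2 / pi\<^sup>2
        \<le> (\<Sum>m\<in>shell (2 ^ i). J m * (sin (lattice_inner m \<xi> / 2))\<^sup>2)" .
    qed auto
    also have "\<dots> \<le> symbol J \<xi>" by (rule symbol_ge_shell_sums[OF nonneg summ I(1)])
    finally show ?thesis .
  qed
  moreover have "0 < 2 * c' / pi\<^sup>2" using c'(1) by simp
  ultimately show thesis by (intro that[of "2 * c' / pi\<^sup>2" N']) auto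
qed

lemma norm_torus_le:
  fixes \<xi> :: "real ^ 'd"
  assumes "\<xi> \<in> torus"
  shows "norm \<xi> \<le> CARD('d) * pi"
proof -
  have "\<bar>\<xi> $ i\<bar> \<le> pi" for i
  proof -
    have "- pi < \<xi> $ i" "\<xi> $ i \<le> pi" using assms by (auto simp: torus_def)
    then show ?thesis by simp
  qed
  then have "(\<Sum>i\<in>UNIV. \<bar>\<xi> $ i\<bar>) \<le> (\<Sum>i\<in>(UNIV::'d set). pi)" by (intro sum_mono)
  then show ?thesis using norm_le_l1_cart[of \<xi>] by simp
qed

lemma symbol_lower:
  fixes J :: "int ^ 'd \<Rightarrow> real"
  assumes "admissible_kernel \<alpha> J"
  shows "\<exists>c>0. \<forall>\<xi>\<in>torus. c * delta \<alpha> (norm \<xi>) \<le> symbol J \<xi>"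
proof -
  have \<alpha>: "0 < \<alpha>" and nonneg: "\<And>n. 0 \<le> J n" and summ: "J summable_on UNIV"
    and "0 < Min (J ` l1_sphere 1)"
    using assms unfolding admissible_kernel_def by auto
  then obtain c\<^sub>0 where c0: "0 < c\<^sub>0" "\<And>\<xi>. \<xi> \<in> torus \<Longrightarrow> c\<^sub>0 * (norm \<xi>)\<^sup>2 \<le> symbol J \<xi>"
    using symbol_ge_quadratic[of J] by blast
  have zero: "c * delta \<alpha> (norm (0 :: real ^ 'd)) \<le> symbol J 0" for c
    by (simp add: symbol_def delta_def)
  have "2 < \<alpha> \<or> \<alpha> = 2 \<or> (\<exists>a. \<alpha> = ereal a \<and> 0 < a \<and> a < 2)"
  proof (cases \<alpha>)
    case (real a)
    then show ?thesis using \<alpha> linorder_less_linear[of a 2] by auto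
  qed (use \<alpha> in auto)
  then consider "2 < \<alpha>" | "\<alpha> = 2" | a where "\<alpha> = ereal a" "0 < a" "a < 2" by blast
  then show ?thesis
  proof cases
    case 1
    then have "delta \<alpha> (norm \<xi>) = (norm \<xi>)\<^sup>2" for \<xi> :: "real ^ 'd"
      by (auto simp: delta_def alpha'_def)
    then show ?thesis using c0 by auto
  next
    case 2
    then have adm: "admissible_kernel (ereal 2) J" using assms by simp
    obtain c i\<^sub>0 where c: "0 < c" and ci: "\<forall>\<xi> I. finite I \<longrightarrow> (\<forall>i\<in>I. i\<^sub>0 \<le> i \<and> 2 ^ i * norm \<xi> \<le> 1)
      \<longrightarrow> (\<Sum>i\<in>I. c * (2 ^ i) powr (2 - 2) * (norm \<xi>)\<^sup>2) \<le> symbol J \<xi>"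
      by (rule symbol_ge_dyadic_sum[OF adm]) (rule that)
    \<comment> \<open>\<open>i\<^sub>0\<close> pays for the discarded small shells, and
      \<open>CARD('d) * pi\<close> for \<open>r > 1\<close>, where \<open>ln r \<le> r\<close> and
      \<open>r\<close> is bounded on the torus.\<close>
    define B where "B = real i\<^sub>0 + CARD('d) * pi"
    define k where "k = 1 / c + (B + 1) / c\<^sub>0"
    have B: "0 \<le> B" by (simp add: B_def)
    have k: "0 < k" using c c0(1) B by (auto simp: k_def intro!: add_pos_nonneg)
    have "1 / k * delta \<alpha> (norm \<xi>) \<le> symbol J \<xi>" if \<xi>: "\<xi> \<in> torus" for \<xi> :: "real ^ 'd"
    proof (cases "\<xi> = 0")
      case False
      define r where "r = norm \<xi>"
      have r: "0 < r" using False by (simp add: r_def)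
      have log: "c * (r\<^sup>2 * (\<bar>ln r\<bar> - B)) \<le> symbol J \<xi>"
      proof (cases "r \<le> 1")
        case True
        obtain I where I: "2 ^ I \<le> 1 / r" "1 / r < 2 ^ Suc I"
          using dyadic_floor_exists[of "1 / r"] r True by auto
        have "\<bar>ln r\<bar> = ln (1 / r)" using r True by (simp add: ln_div)
        also have "\<dots> \<le> ln (2 ^ Suc I)" using I(2) r by (subst ln_le_cancel_iff) auto
        also have "\<dots> = real (Suc I) * ln 2" by (rule ln_realpow)
        also have "\<dots> \<le> real (Suc I) * 1" using ln_2_less_1 by (intro mult_left_mono) auto
        finally have "\<bar>ln r\<bar> \<le> real (Suc I)" by simp
        moreover have "0 \<le> CARD('d) * pi" by simp
        ultimately have "\<bar>ln r\<bar> - B \<le> real (Suc I) - real i\<^sub>0" unfolding B_def by linarith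
        \<comment> \<open>The cardinality is the truncated difference
          \<open>Suc I - i\<^sub>0\<close>, so an empty range is covered too.\<close>
        also have "\<dots> \<le> real (card {i\<^sub>0..I})" by simp
        finally have "c * (r\<^sup>2 * (\<bar>ln r\<bar> - B)) \<le> c * (r\<^sup>2 * real (card {i\<^sub>0..I}))"
          using c by (intro mult_left_mono) auto
        also have "\<dots> = (\<Sum>i\<in>{i\<^sub>0..I}. c * (2 ^ i) powr (2 - 2) * (norm \<xi>)\<^sup>2)"
          by (simp add: r_def)
        also have "\<dots> \<le> symbol J \<xi>"
        proof (intro ci[rule_format])
          fix i assume i: "i \<in> {i\<^sub>0..I}"
          then have "(2::real) ^ i \<le> 2 ^ I" by (intro power_increasing) auto
          with I(1) have "2 ^ i \<le> 1 / r" by linarith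
          then show "i\<^sub>0 \<le> i \<and> 2 ^ i * norm \<xi> \<le> 1" using i r by (simp add: r_def field_simps)
        qed simp
        finally show ?thesis .
      next
        case False
        then have "\<bar>ln r\<bar> \<le> r" using ln_le_minus_one[of r] by simp
        also have "\<dots> \<le> B" using norm_torus_le[OF \<xi>] by (simp add: B_def r_def)
        finally have "c * (r\<^sup>2 * (\<bar>ln r\<bar> - B)) \<le> 0" using c by (auto simp: mult_le_0_iff)
        also have "0 \<le> c\<^sub>0 * (norm \<xi>)\<^sup>2" using c0(1) by simp
        also have "\<dots> \<le> symbol J \<xi>" by (rule c0(2)[OF \<xi>])
        finally show ?thesis .
      qed
      \<comment> \<open>The bracket is at most \<open>(\<bar>ln r\<bar> - B) + (B + 1)\<close>:
        dyadic shells pay for the first summand, nearest neighbours for the second. This explains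
        the two terms of \<open>k\<close>.\<close>
      have "delta \<alpha> r = r\<^sup>2 * japanese_bracket (ln r)" using r 2 by (simp add: delta_def)
      also have "\<dots> \<le> r\<^sup>2 * ((\<bar>ln r\<bar> - B) + (B + 1))"
        using japanese_bracket_le[of "ln r"] by (intro mult_left_mono) auto
      also have "\<dots> = r\<^sup>2 * (\<bar>ln r\<bar> - B) + (B + 1) * r\<^sup>2" by (simp add: algebra_simps)
      also have "\<dots> \<le> symbol J \<xi> / c + (B + 1) * (symbol J \<xi> / c\<^sub>0)"
        using log c0(2)[OF \<xi>] c c0(1) B
        by (intro add_mono mult_left_mono) (auto simp: r_def field_simps)
      also have "\<dots> = k * symbol J \<xi>" by (simp add: k_def distrib_right)
      finally show ?thesis using k by (simp add: r_def field_simps)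
    qed (simp only: zero)
    then show ?thesis using k by (intro exI[of _ "1 / k"]) auto
  next
    case (3 a)
    then have adm: "admissible_kernel (ereal a) J" using assms by simp
    obtain c i\<^sub>0 where c: "0 < c" and ci: "\<forall>\<xi> I. finite I \<longrightarrow> (\<forall>i\<in>I. i\<^sub>0 \<le> i \<and> 2 ^ i * norm \<xi> \<le> 1)
      \<longrightarrow> (\<Sum>i\<in>I. c * (2 ^ i) powr (2 - a) * (norm \<xi>)\<^sup>2) \<le> symbol J \<xi>"
      by (rule symbol_ge_dyadic_sum[OF adm]) (rule that)
    \<comment> \<open>\<open>c1\<close> allows for the factor below 2 between \<open>2 ^ I\<close>
      and \<open>1 / r\<close>; \<open>c2\<close> serves \<open>1 / r < 2 ^ i\<^sub>0\<close>, where
      \<open>r powr a\<close> is at most a constant times \<open>r\<^sup>2\<close>.\<close>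
    define c1 where "c1 = c / 2 powr (2 - a)"
    define c2 where "c2 = c\<^sub>0 / (2 ^ i\<^sub>0) powr (2 - a)"
    have c12: "0 < c1" "0 < c2" using c c0(1) by (auto simp: c1_def c2_def)
    have "min c1 c2 * delta \<alpha> (norm \<xi>) \<le> symbol J \<xi>" if \<xi>: "\<xi> \<in> torus" for \<xi> :: "real ^ 'd"
    proof (cases "\<xi> = 0")
      case False
      define r where "r = norm \<xi>"
      have r: "0 < r" using False by (simp add: r_def)
      have rpow: "r powr a = (1 / r) powr (2 - a) * r\<^sup>2"
        using r by (simp add: powr_divide powr_diff field_simps)
      have "min c1 c2 * r powr a \<le> symbol J \<xi>"
      proof (cases "2 ^ i\<^sub>0 \<le> 1 / r")
        case True
        moreover have "(1::real) \<le> 2 ^ i\<^sub>0" by simp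
        ultimately have "1 \<le> 1 / r" by linarith
        then obtain I where I: "2 ^ I \<le> 1 / r" "1 / r < 2 ^ Suc I" using dyadic_floor_exists by blast
        have "(2::real) ^ i\<^sub>0 < 2 ^ Suc I" using True I(2) by linarith
        then have "i\<^sub>0 \<le> I" by (metis less_Suc_eq_le power_less_imp_less_exp one_less_numeral_iff semiring_norm(76))
        have "min c1 c2 * r powr a \<le> c1 * ((1 / r) powr (2 - a) * r\<^sup>2)"
          unfolding rpow by (intro mult_right_mono) auto
        also have "\<dots> \<le> c1 * ((2 ^ Suc I) powr (2 - a) * r\<^sup>2)"
          using I(2) r 3 c12 by (intro mult_left_mono mult_right_mono powr_mono2) auto
        also have "\<dots> = (\<Sum>i\<in>{I}. c * (2 ^ i) powr (2 - a) * (norm \<xi>)\<^sup>2)"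
          by (simp add: c1_def powr_mult r_def)
        also have "\<dots> \<le> symbol J \<xi>"
          using I(1) r \<open>i\<^sub>0 \<le> I\<close> by (intro ci[rule_format]) (auto simp: r_def field_simps)
        finally show ?thesis .
      next
        case False
        have "min c1 c2 * r powr a \<le> c2 * ((1 / r) powr (2 - a) * r\<^sup>2)"
          unfolding rpow by (intro mult_right_mono) auto
        also have "\<dots> \<le> c2 * ((2 ^ i\<^sub>0) powr (2 - a) * r\<^sup>2)"
          using False r 3 c12 by (intro mult_left_mono mult_right_mono powr_mono2) auto
        also have "\<dots> = c\<^sub>0 * (norm \<xi>)\<^sup>2" by (simp add: c2_def r_def)
        also have "\<dots> \<le> symbol J \<xi>" by (rule c0(2)[OF \<xi>])
        finally show ?thesis .
      qed
      then show ?thesis using r 3 by (simp add: r_def delta_ereal)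
    qed (simp only: zero)
    then show ?thesis using c12 by (intro exI[of _ "min c1 c2"]) auto
  qed
qed

theorem proposition3p1:
  fixes J :: "int ^ 'd \<Rightarrow> real" and \<alpha> :: ereal
  assumes "admissible_kernel \<alpha> J"
  shows "\<exists>c C. 0 < c \<and> c \<le> C \<and>
    (\<forall>\<xi>\<in>torus. c * delta \<alpha> (norm \<xi>) \<le> symbol J \<xi> \<and> symbol J \<xi> \<le> C * delta \<alpha> (norm \<xi>))"
proof -
  obtain c where c: "0 < c" "\<And>\<xi>. \<xi> \<in> torus \<Longrightarrow> c * delta \<alpha> (norm \<xi>) \<le> symbol J \<xi>"
    using symbol_lower[OF assms] by blast
  obtain C where C: "0 < C" "\<And>\<xi>. symbol J \<xi> \<le> C * delta \<alpha> (norm \<xi>)"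
    using symbol_upper[OF assms] by blast
  have "delta \<alpha> r \<ge> 0" for r
    using japanese_bracket_ge(1)[of "ln r"] by (auto simp: delta_def)
  \<comment> \<open>The maximum secures the required order of the two constants.\<close>
  then have "C * delta \<alpha> r \<le> max c C * delta \<alpha> r" for r by (intro mult_right_mono) auto
  then have "symbol J \<xi> \<le> max c C * delta \<alpha> (norm \<xi>)" for \<xi> using C(2) order_trans by blast
  then show ?thesis using c by (intro exI[of _ c] exI[of _ "max c C"]) auto
qed

end
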